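(* For all $n\ge1$ and $1\le m\le n$, the numbers of permutations of $[n]$ with $m$ cycles that cyclically avoid 3--1--2, that cyclically avoid 2--3--1, and that cyclically avoid 2--1--3 are all equal to the number of Dyck paths of semilength $n$ with $m$ returns to the $x$-axis, namely \[\frac{m}{2n-m}\binom{2n-m}{n}.\]
   Context: The standard cycle form writes each cycle starting with its smallest element, cycles listed in decreasing order of smallest elements; $\Psi(\pi)$ is the word obtained by deleting the parentheses. $\pi$ cyclically avoids the classical pattern $\sigma$ if the word $\Psi(\pi)$ has no indices $i<j<k$ with $\Psi(\pi)_i\Psi(\pi)_j\Psi(\pi)_k$ order-isomorphic to $\sigma$. A Dyck path of semilength $n$ is a lattice path from $(0,0)$ to $(2n,0)$ with steps $(1,1)$, $(1,-1)$ never going below the $x$-axis; a return is any visit to the $x$-axis other than the starting point. *)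

theory Defs
  imports Complex_Main "HOL-Combinatorics.Cycles" "HOL-Combinatorics.Orbits"
begin

(* Fixed points count as cycles of length 1. *)
definition cycle_sets :: "nat \<Rightarrow> (nat \<Rightarrow> nat) \<Rightarrow> nat set set" where
  "cycle_sets n p = orbit p ` {1..n}"

definition num_cycles :: "nat \<Rightarrow> (nat \<Rightarrow> nat) \<Rightarrow> nat" where
  "num_cycles n p = card (cycle_sets n p)"

(* The standard cycle form: "support p a" is the cycle of a written starting with a,
   that is a, p a, p (p a), ... *)
definition standard_cycle_form :: "nat \<Rightarrow> (nat \<Rightarrow> nat) \<Rightarrow> nat list list" where
  "standard_cycle_form n p =
     map (support p) (rev (sorted_list_of_set (Min ` cycle_sets n p)))"

definition Psi :: "nat \<Rightarrow> (nat \<Rightarrow> nat) \<Rightarrow> nat list" where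
  "Psi n p = concat (standard_cycle_form n p)"

definition order_isomorphic :: "nat list \<Rightarrow> nat list \<Rightarrow> bool" where
  "order_isomorphic u v \<longleftrightarrow> length u = length v \<and>
     (\<forall>i<length u. \<forall>j<length u. u ! i < u ! j \<longleftrightarrow> v ! i < v ! j)"

(* Only meaningful for patterns s of length 3. *)
definition avoids3 :: "nat list \<Rightarrow> nat list \<Rightarrow> bool" where
  "avoids3 w s \<longleftrightarrow> \<not> (\<exists>i j k. i < j \<and> j < k \<and> k < length w \<and>
     order_isomorphic [w ! i, w ! j, w ! k] s)"

definition cyclically_avoids :: "nat \<Rightarrow> (nat \<Rightarrow> nat) \<Rightarrow> nat list \<Rightarrow> bool" where
  "cyclically_avoids n p s \<longleftrightarrow> avoids3 (Psi n p) s"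

definition cyclic_avoiders :: "nat \<Rightarrow> nat \<Rightarrow> nat list \<Rightarrow> (nat \<Rightarrow> nat) set" where
  "cyclic_avoiders n m s =
     {p. p permutes {1..n} \<and> num_cycles n p = m \<and> cyclically_avoids n p s}"

(* A path is the list of the vertical components of its steps (1, 1) and (1, -1), so that
   its height over x-coordinate k is the sum of the first k entries. *)
definition path_height :: "int list \<Rightarrow> nat \<Rightarrow> int" where
  "path_height d k = sum_list (take k d)"

definition dyck_paths :: "nat \<Rightarrow> int list set" where
  "dyck_paths n = {d. length d = 2 * n \<and> set d \<subseteq> {1, -1} \<and>
     path_height d (2 * n) = 0 \<and> (\<forall>k\<le>2 * n. path_height d k \<ge> 0)}"

definition num_returns :: "int list \<Rightarrow> nat" where
  "num_returns d = card {k. 0 < k \<and> k \<le> length d \<and> path_height d k = 0}"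

end

(* Deleting the parentheses is a bijection from the permutations of [n] onto the words on [n]
   that turns the number of cycles into the number of left-to-right minima. Let b(n, m) count the
   avoiding words with m left-to-right minima. All three patterns give
   b(n + 1, m + 1) = b(n, m) + b(n, m + 1) + ... + b(n, n). For 3-1-2 the first letter of such a word
   is forced to be the letter of rank m, and it can be put in front of any avoiding word on the
   other letters with at least m minima. For 2-3-1 and 2-1-3 one deletes the smallest letter; the
   place where it can be put back is determined by m. The same numbers count Dyck paths
   by returns: more generally b(h + u, h + m - 1) counts the paths from height h > 0 down
   to 0 with u up-steps and m returns. *)
theory Submission
  imports Defs "HOL-Combinatorics.Multiset_Permutations"
begin

section \<open>The ballot triangle\<close>

text \<open>The numbers b(n, m), defined by the recurrence that all three word classes will be shown
  to satisfy; the row sums are Catalan numbers. The sum stops at n because n letters have at most n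
  minima.\<close>

fun ballot :: "nat \<Rightarrow> nat \<Rightarrow> nat" where
  "ballot 0 m = (if m = 0 then 1 else 0)"
| "ballot (Suc n) 0 = 0"
| "ballot (Suc n) (Suc m) = (\<Sum>j=m..n. ballot n j)"

lemma ballot_eq_0: "n < m \<Longrightarrow> ballot n m = 0"
  by (cases n; cases m) auto

text \<open>Splitting off the summand j = m leaves the sum that defines the next entry of the row.
  This two-term form matches both Pascal's rule and the choice of the first step of a path.\<close>

lemma ballot_rec: "ballot (Suc n) (Suc m) = ballot n m + ballot (Suc n) (Suc (Suc m))"
proof (cases "m \<le> n")
  case True
  then show ?thesis by (simp add: sum.atLeast_Suc_atMost)
next
  case False
  then show ?thesis by (simp add: ballot_eq_0)
qed

text \<open>The reflection-principle formula, a difference of two neighbouring binomials, written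
  additively to stay clear of truncated subtraction. It follows from \<open>ballot_rec\<close> and
  Pascal's rule.\<close>

lemma ballot_add_binomial:
  "m \<le> Suc n \<Longrightarrow> ballot (Suc n) m + (2 * n + 1 - m choose Suc n) = (2 * n + 1 - m choose n)"
proof (induction n arbitrary: m)
  case 0
  then show ?case by (cases m) auto
next
  case (Suc n)
  note IH = Suc.IH
  show ?case
  proof (cases m)
    case 0
    \<comment> \<open>In column 0 the ballot number vanishes, and the two binomials are mirror
      images in an odd row of Pascal's triangle.\<close>
    have "(2 * Suc n + 1 choose Suc n) = (2 * Suc n + 1 choose (2 * Suc n + 1 - Suc n))"
      by (rule binomial_symmetric) simp
    also have "2 * Suc n + 1 - Suc n = Suc (Suc n)" by simp
    finally show ?thesis using 0 by simp
  next
    case (Suc k)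
    \<comment> \<open>Inside a row the induction runs from right to left, on the distance to the
      last entry, which equals 1. The outer hypothesis supplies the entry from the row
      above.\<close>
    have *: "k \<le> Suc n \<Longrightarrow> ballot (Suc (Suc n)) (Suc k) + (2 * Suc n + 1 - Suc k choose Suc (Suc n)) =
        (2 * Suc n + 1 - Suc k choose Suc n)" for k
    proof (induction "Suc n - k" arbitrary: k)
      case 0
      then have "k = Suc n" by simp
      moreover have "ballot (Suc n) (Suc n) = 1" for n
        by (induction n) auto
      ultimately show ?case by (simp del: ballot.simps)
    next
      case (Suc d)
      then have "k \<le> n" by simp
      obtain r where r: "2 * n + 1 - k = r" "2 * Suc n + 1 - Suc (Suc k) = r"
          "2 * Suc n + 1 - Suc k = Suc r"
        using \<open>k \<le> n\<close> by (simp add: Suc_diff_le)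
      have "ballot (Suc (Suc n)) (Suc (Suc k)) + (r choose Suc (Suc n)) = (r choose Suc n)"
        using Suc.hyps(1)[of "Suc k"] Suc.hyps(2) \<open>k \<le> n\<close> r by (simp del: ballot.simps)
      moreover have "ballot (Suc n) k + (r choose Suc n) = (r choose n)"
        using IH[of k] \<open>k \<le> n\<close> r by (simp del: ballot.simps)
      ultimately show ?case
        using ballot_rec[of "Suc n" k] r by (simp del: ballot.simps)
    qed
    show ?thesis using *[of k] Suc Suc.prems by simp
  qed
qed

text \<open>With r = 2n - m - 1 the ballot number is C(r, n-1) - C(r, n). Absorption and Pascal's
  rule merge this difference into one multiple of C(r+1, n).\<close>

lemma ballot_closed_form:
  assumes "1 \<le> n" "m \<le> n"
  shows "real (ballot n m) = real m / real (2 * n - m) * real (2 * n - m choose n)"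
proof -
  obtain k where n: "n = Suc k" using assms by (cases n) auto
  obtain r where r: "2 * n - m = Suc r" "2 * k + 1 - m = r"
    using assms n by (cases "2 * n - m") auto
  have 1: "real (ballot n m) + real (r choose n) = real (r choose k)"
    using ballot_add_binomial[of m k] assms n r by (simp del: ballot.simps flip: of_nat_add)
  have "Suc r * (r choose k) = (Suc r choose Suc k) * Suc k"
    by (rule Suc_times_binomial_eq)
  then have 2: "real (Suc r) * real (r choose k) = real n * real (Suc r choose n)"
    unfolding n by (metis mult.commute of_nat_mult)
  have 3: "real (Suc r choose n) = real (r choose k) + real (r choose n)"
    unfolding n by simp
  \<comment> \<open>Writing m as 2n - (r+1) makes absorption applicable to the part with factor n,
    after which r + 1 is a common factor.\<close>
  have "real m = 2 * real n - real (Suc r)"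
    using r assms by linarith
  then have "real m * real (Suc r choose n) =
      2 * (real n * real (Suc r choose n)) - real (Suc r) * real (Suc r choose n)"
    by (simp add: left_diff_distrib)
  also have "\<dots> = real (Suc r) * (2 * real (r choose k)) - real (Suc r) * real (Suc r choose n)"
    using 2 by simp
  also have "\<dots> = real (Suc r) * (real (r choose k) - real (r choose n))"
    unfolding 3 by (simp add: algebra_simps)
  also have "\<dots> = real (Suc r) * real (ballot n m)"
    using 1 by simp
  finally have "real (Suc r) * real (ballot n m) = real m * real (Suc r choose n)"
    by simp
  then show ?thesis unfolding r by (simp add: field_simps)
qed

section \<open>Dyck paths\<close>

text \<open>An arbitrary starting height makes the class closed under removal of the first step,
  which the induction on the length requires.\<close>

fun path_to_zero :: "int \<Rightarrow> int list \<Rightarrow> bool" where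
  "path_to_zero h [] \<longleftrightarrow> h = 0"
| "path_to_zero h (s # d) \<longleftrightarrow> 0 \<le> h \<and> s \<in> {1, -1} \<and> path_to_zero (h + s) d"

fun returns_from :: "int \<Rightarrow> int list \<Rightarrow> nat" where
  "returns_from h [] = 0"
| "returns_from h (s # d) = (if h + s = 0 then 1 else 0) + returns_from (h + s) d"

definition paths_from :: "int \<Rightarrow> nat \<Rightarrow> nat \<Rightarrow> int list set" where
  "paths_from h l m = {d. length d = l \<and> path_to_zero h d \<and> returns_from h d = m}"

lemma all_le_Suc_iff: "(\<forall>k\<le>Suc n. P k) \<longleftrightarrow> P 0 \<and> (\<forall>k\<le>n. P (Suc k))"
  by (metis Suc_le_mono le0 not0_implies_Suc)

text \<open>Bridge to the prefix-sum description: for h = 0 the right-hand side is the condition in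
  \<open>dyck_paths\<close>.\<close>

lemma path_to_zero_iff:
  "path_to_zero h d \<longleftrightarrow> set d \<subseteq> {1, -1} \<and> h + path_height d (length d) = 0 \<and>
     (\<forall>k\<le>length d. 0 \<le> h + path_height d k)"
proof (induction d arbitrary: h)
  case (Cons s d)
  show ?case
    by (simp add: Cons.IH path_height_def all_le_Suc_iff add.assoc) auto
qed (auto simp: path_height_def)

lemma returns_from_eq_card:
  "returns_from h d = card {k. 0 < k \<and> k \<le> length d \<and> h + path_height d k = 0}"
proof (induction d arbitrary: h)
  case (Cons s d)
  let ?S = "{k. 0 < k \<and> k \<le> length d \<and> (h + s) + path_height d k = 0}"
  have "{k. 0 < k \<and> k \<le> length (s # d) \<and> h + path_height (s # d) k = 0} =
      (if h + s = 0 then {1} else {}) \<union> Suc ` ?S" (is "?A = ?B")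
  proof (rule set_eqI)
    fix k
    show "k \<in> ?A \<longleftrightarrow> k \<in> ?B"
    proof (cases k)
      case (Suc j)
      show ?thesis
        by (cases j) (auto simp: Suc path_height_def add.assoc image_iff)
    qed auto
  qed
  moreover have "card (Suc ` ?S) = card ?S" by (simp add: card_image)
  moreover have "1 \<notin> Suc ` ?S" by auto
  ultimately show ?case using Cons.IH[of "h + s"] by auto
qed (auto simp: path_height_def)

lemma dyck_paths_returns_eq:
  "{d \<in> dyck_paths n. num_returns d = m} = paths_from 0 (2 * n) m"
  unfolding dyck_paths_def paths_from_def num_returns_def path_to_zero_iff returns_from_eq_card
  by auto

text \<open>A step lowers the height by at most 1. This bound yields the empty boundary cases of the
  path recurrence.\<close>

lemma path_to_zero_le_length: "path_to_zero h d \<Longrightarrow> 0 \<le> h \<and> h \<le> int (length d)"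
  by (induction d arbitrary: h) force+

lemma paths_from_eq_empty: "int l < h \<or> h < 0 \<Longrightarrow> paths_from h l m = {}"
  using path_to_zero_le_length by (fastforce simp: paths_from_def)

lemma finite_paths_from: "finite (paths_from h l m)"
proof (rule finite_subset)
  show "paths_from h l m \<subseteq> {d. set d \<subseteq> {1, -1} \<and> length d = l}"
    by (auto simp: paths_from_def path_to_zero_iff)
qed (simp add: finite_lists_length_eq)

text \<open>Decomposition by the first step. Only a down-step from height 1 makes an immediate
  return, since an up-step ends above 0. The case m = 0 is separate because m - 1 is truncated
  there.\<close>

lemma paths_from_Suc:
  assumes "0 \<le> h"
  shows "paths_from h (Suc l) m = (#) 1 ` paths_from (h + 1) l m \<union>
     (#) (- 1) ` (if h = 1 then (if m = 0 then {} else paths_from 0 l (m - 1)) else paths_from (h - 1) l m)"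
  (is "?A = ?B")
proof (rule set_eqI)
  fix d
  show "d \<in> ?A \<longleftrightarrow> d \<in> ?B"
    using assms by (cases d) (auto simp: paths_from_def image_iff)
qed

lemma card_paths_from_Suc:
  assumes "0 \<le> h"
  shows "card (paths_from h (Suc l) m) = card (paths_from (h + 1) l m) +
     (if h = 1 then (if m = 0 then 0 else card (paths_from 0 l (m - 1))) else card (paths_from (h - 1) l m))"
  unfolding paths_from_Suc[OF assms]
  by (subst card_Un_disjoint) (auto simp: finite_paths_from card_image)

text \<open>A path of length h + 2u from height h to 0 has u up-steps. For h > 0 the first-step
  decomposition becomes exactly \<open>ballot_rec\<close>; for h = 0 the first step must go up and
  reduces to height 1.\<close>

lemma card_paths_from:
  "card (paths_from (int h) (h + 2 * u) m) =
     (if h = 0 then ballot u m else if m = 0 then 0 else ballot (h + u) (h + m - 1))"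
proof (induction "h + 2 * u" arbitrary: h u m)
  case 0
  then show ?case
    by (cases m) (auto simp: paths_from_def cong: conj_cong)
next
  case (Suc l)
  show ?case
  proof (cases h)
    case 0
    then obtain v where u: "u = Suc v" "l = 1 + 2 * v" using Suc.hyps(2) by (cases u) auto
    show ?thesis
      using Suc.hyps(1)[of 1 v m] 0 u card_paths_from_Suc[of 0 "1 + 2 * v" m]
      by (cases m) (auto simp: paths_from_eq_empty simp del: ballot.simps(3))
  next
    case h: (Suc g)
    \<comment> \<open>An up-step trades one unit of u for one unit of height. With u = 0 too few
      steps remain to come down, and for m > 0 the ballot number vanishes because its second
      argument exceeds the first.\<close>
    have up: "card (paths_from (int h + 1) l m) = (if m = 0 then 0 else ballot (h + u) (h + m))"
    proof (cases u)
      case 0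
      then show ?thesis using Suc.hyps(2) h by (simp add: paths_from_eq_empty ballot_eq_0)
    next
      case (Suc v)
      then show ?thesis using Suc.hyps(1)[of "Suc h" v m] Suc.hyps(2) h
        by (simp add: add.commute del: ballot.simps)
    qed
    have down: "card (paths_from (int g) l k) =
        (if g = 0 then ballot u k else if k = 0 then 0 else ballot (g + u) (g + k - 1))" for k
      using Suc.hyps(1)[of g u k] Suc.hyps(2) h by simp
    have "card (paths_from (int h) (Suc l) m) = card (paths_from (int h + 1) l m) +
       (if h = 1 then (if m = 0 then 0 else card (paths_from (int g) l (m - 1))) else card (paths_from (int g) l m))"
      using h by (subst card_paths_from_Suc) auto
    also have "\<dots> = (if m = 0 then 0 else ballot (h + u) (h + m - 1))"
    proof (cases m)
      case 0
      then show ?thesis unfolding up down using h by simp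
    next
      case (Suc k)
      \<comment> \<open>For g = 0 the down-step uses up one return, for g > 0 none; either way it
        contributes \<open>ballot (g + u) (g + m - 1)\<close>.\<close>
      show ?thesis
        unfolding up down using h Suc ballot_rec[of "g + u" "g + m - 1"]
        by (simp del: ballot.simps)
    qed
    finally show ?thesis using Suc.hyps(2) h by simp
  qed
qed

lemma card_dyck_paths_returns: "card {d \<in> dyck_paths n. num_returns d = m} = ballot n m"
  using card_paths_from[of 0 n m] by (simp add: dyck_paths_returns_eq)

section \<open>Left-to-right minima and pattern avoidance of words\<close>

text \<open>Every minimum after the first letter lies below it, so the other letters can be
  discarded before recursing.\<close>

fun lr_minima :: "nat list \<Rightarrow> nat" where
  "lr_minima [] = 0"
| "lr_minima (x # xs) = Suc (lr_minima (filter (\<lambda>y. y < x) xs))"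

text \<open>The ternary analogue of \<open>sorted_wrt\<close>: pattern avoidance without indices,
  suited to induction on words.\<close>

fun triplewise :: "('a \<Rightarrow> 'a \<Rightarrow> 'a \<Rightarrow> bool) \<Rightarrow> 'a list \<Rightarrow> bool" where
  "triplewise P [] = True"
| "triplewise P (x # xs) \<longleftrightarrow> sorted_wrt (P x) xs \<and> triplewise P xs"

lemma lr_minima_append:
  "lr_minima (u @ v) = lr_minima u + lr_minima (filter (\<lambda>y. \<forall>x\<in>set u. y < x) v)"
proof (induction u arbitrary: v rule: lr_minima.induct)
  case (2 x xs)
  \<comment> \<open>Being below x already implies being below every letter that is at least x, so
    the discarded letters of \<open>xs\<close> impose no further condition.\<close>
  have "filter (\<lambda>y. \<forall>z\<in>set (filter (\<lambda>y. y < x) xs). y < z) (filter (\<lambda>y. y < x) v) =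
      filter (\<lambda>y. \<forall>z\<in>set (x # xs). y < z) v"
    by (auto intro!: filter_cong simp: not_less)
  then show ?case using 2 by simp
qed simp

lemma lr_minima_le_length: "lr_minima w \<le> length w"
proof (induction w rule: lr_minima.induct)
  case (2 x xs)
  then show ?case using length_filter_le[of "\<lambda>y. y < x" xs] by (simp del: length_filter_le)
qed simp

lemma lr_minima_decreasing: "sorted_wrt (>) w \<Longrightarrow> lr_minima w = length w"
proof (induction w)
  case (Cons x xs)
  then have "filter (\<lambda>y. y < x) xs = xs" by (simp add: filter_id_conv)
  with Cons show ?case by simp
qed simp

lemma lr_minima_pos: "w \<noteq> [] \<Longrightarrow> 0 < lr_minima w"
  by (cases w) auto

text \<open>Nothing after the smallest letter can be a minimum. Hence the number of minima depends
  only on the part before that letter, which is what governs its reinsertion for 2-3-1 and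
  2-1-3.\<close>

lemma lr_minima_append_Min:
  assumes "\<forall>x\<in>set u. a < x" "\<forall>x\<in>set v. a < x"
  shows "lr_minima (u @ a # v) = Suc (lr_minima u)"
proof -
  have "filter (\<lambda>y. y < a) (filter (\<lambda>y. \<forall>x\<in>set u. y < x) v) = []"
    using assms by (auto simp: filter_empty_conv)
  then show ?thesis using assms by (simp add: lr_minima_append)
qed

text \<open>A minimum of the filtered word is below v, hence also below all dropped letters before
  it, and so is a minimum of w.\<close>

lemma lr_minima_filter_less_le: "lr_minima (filter (\<lambda>y. y < v) w) \<le> lr_minima w"
proof (induction w rule: lr_minima.induct)
  case (2 x xs)
  show ?case
  proof (cases "x < v")
    case True
    then have "filter (\<lambda>y. y < x) (filter (\<lambda>y. y < v) xs) = filter (\<lambda>y. y < x) xs"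
      by (auto intro!: filter_cong)
    then show ?thesis using True by simp
  next
    case False
    then have "filter (\<lambda>y. y < v) (filter (\<lambda>y. y < x) xs) = filter (\<lambda>y. y < v) xs"
      by (auto intro!: filter_cong)
    then show ?thesis using False 2 by simp
  qed
qed simp

lemma sorted_wrt_if_all: "(\<And>x y. x \<in> set xs \<Longrightarrow> y \<in> set xs \<Longrightarrow> P x y) \<Longrightarrow> sorted_wrt P xs"
  by (induction xs) auto

text \<open>The four conjuncts are the ways a triple can be distributed over u and v: 3+0, 0+3, 1+2
  and 2+1.\<close>

lemma triplewise_append:
  "triplewise P (u @ v) \<longleftrightarrow> triplewise P u \<and> triplewise P v \<and>
     (\<forall>x\<in>set u. sorted_wrt (P x) v) \<and> (\<forall>z\<in>set v. sorted_wrt (\<lambda>x y. P x y z) u)"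
  by (induction u) (auto simp: sorted_wrt_append sorted_wrt_if_all)

lemma triplewise_iff_nth:
  "triplewise P w \<longleftrightarrow> (\<forall>i j k. i < j \<and> j < k \<and> k < length w \<longrightarrow> P (w ! i) (w ! j) (w ! k))"
proof (induction w)
  case (Cons x xs)
  show ?case (is "?L \<longleftrightarrow> ?R")
  proof
    assume L: ?L
    show ?R
    proof (intro allI impI)
      fix i j k
      assume *: "i < j \<and> j < k \<and> k < length (x # xs)"
      then obtain j' k' where jk: "j = Suc j'" "k = Suc k'"
        by (metis gr_implies_not0 not0_implies_Suc)
      show "P ((x # xs) ! i) ((x # xs) ! j) ((x # xs) ! k)"
      proof (cases i)
        case 0
        then show ?thesis using L * jk by (simp add: sorted_wrt_iff_nth_less)
      next
        case (Suc i')
        then show ?thesis using L * jk Cons.IH by auto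
      qed
    qed
  next
    assume R: ?R
    have "sorted_wrt (P x) xs"
      unfolding sorted_wrt_iff_nth_less
    proof (intro allI impI)
      fix i j assume "i < j" "j < length xs"
      then show "P x (xs ! i) (xs ! j)" using R[rule_format, of 0 "Suc i" "Suc j"] by simp
    qed
    moreover have "triplewise P xs"
      unfolding Cons.IH
    proof (intro allI impI)
      fix i j k assume "i < j \<and> j < k \<and> k < length xs"
      then show "P (xs ! i) (xs ! j) (xs ! k)"
        using R[rule_format, of "Suc i" "Suc j" "Suc k"] by simp
    qed
    ultimately show ?L by simp
  qed
qed simp

lemma avoids3_iff_triplewise:
  "avoids3 w s \<longleftrightarrow> triplewise (\<lambda>a b c. \<not> order_isomorphic [a, b, c] s) w"
  unfolding avoids3_def triplewise_iff_nth by blast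

lemma all_less_3_iff: "(\<forall>i<3. P i) \<longleftrightarrow> P 0 \<and> P 1 \<and> P (2 :: nat)"
  by (auto simp: less_Suc_eq numeral_eq_Suc)

text \<open>A chain of two strict inequalities fixes all nine comparisons among three
  letters.\<close>

lemma order_isomorphic_patterns:
  "order_isomorphic [a, b, c] [3, 1, 2] \<longleftrightarrow> b < c \<and> c < a"
  "order_isomorphic [a, b, c] [2, 3, 1] \<longleftrightarrow> c < a \<and> a < b"
  "order_isomorphic [a, b, c] [2, 1, 3] \<longleftrightarrow> b < a \<and> a < c"
  by (auto simp: order_isomorphic_def all_less_3_iff[unfolded numeral_3_eq_3] numeral_3_eq_3)

section \<open>Avoiding words over a finite alphabet and their common recurrence\<close>

text \<open>An arbitrary alphabet A lets a letter be deleted without relabelling the remaining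
  ones.\<close>

definition avoiders :: "(nat \<Rightarrow> nat \<Rightarrow> nat \<Rightarrow> bool) \<Rightarrow> nat set \<Rightarrow> nat list set" where
  "avoiders P A = {w. distinct w \<and> set w = A \<and> triplewise P w}"

lemma finite_avoiders: "finite (avoiders P A)"
proof (rule finite_subset)
  show "avoiders P A \<subseteq> permutations_of_set A"
    by (auto simp: avoiders_def permutations_of_set_def)
qed simp

lemma lr_minima_le_card: "w \<in> avoiders P A \<Longrightarrow> lr_minima w \<le> card A"
  using lr_minima_le_length[of w] by (auto simp: avoiders_def distinct_card)

text \<open>Common frame for the three patterns: sorting the target of the bijection by its exact
  number of minima gives the defining sum of \<open>ballot\<close>. The deleted letter v may depend
  on A and m.\<close>

lemma card_avoiders_eq_ballot:
  assumes rec: "\<And>A m. finite A \<Longrightarrow> m < card A \<Longrightarrow> \<exists>v\<in>A. \<exists>f.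
      bij_betw f {w \<in> avoiders P A. lr_minima w = Suc m} {w \<in> avoiders P (A - {v}). m \<le> lr_minima w}"
  assumes "finite A"
  shows "card {w \<in> avoiders P A. lr_minima w = m} = ballot (card A) m"
  using \<open>finite A\<close>
proof (induction "card A" arbitrary: A m)
  case 0
  then have "avoiders P A = {[]}" by (auto simp: avoiders_def)
  then show ?case using 0 by (cases m) (auto cong: conj_cong simp: Collect_conv_if)
next
  case (Suc n)
  show ?case
  proof (cases m)
    case 0
    have "w \<noteq> []" if "w \<in> avoiders P A" for w
      using that Suc.hyps by (auto simp: avoiders_def)
    then have "{w \<in> avoiders P A. lr_minima w = m} = {}"
      using 0 lr_minima_pos by fastforce
    then have "card {w \<in> avoiders P A. lr_minima w = m} = 0"
      by (simp only: card.empty)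
    then show ?thesis using 0 Suc.hyps(2)[symmetric] by simp
  next
    case m: (Suc k)
    show ?thesis
    proof (cases "k < card A")
      \<comment> \<open>A word cannot have more minima than letters, so both sides are 0.\<close>
      case False
      then have "{w \<in> avoiders P A. lr_minima w = m} = {}"
        using m lr_minima_le_card by fastforce
      then show ?thesis using False m by (simp only: card.empty) (simp add: ballot_eq_0)
    next
      case True
      from rec[OF \<open>finite A\<close> True] obtain v f where v: "v \<in> A" and
        bij: "bij_betw f {w \<in> avoiders P A. lr_minima w = Suc k} {w \<in> avoiders P (A - {v}). k \<le> lr_minima w}"
        by blast
      have n: "n = card (A - {v})" "finite (A - {v})"
        using Suc.hyps(2) v Suc.prems by auto
      have "{w \<in> avoiders P (A - {v}). k \<le> lr_minima w} =
          (\<Union>j\<in>{k..n}. {w \<in> avoiders P (A - {v}). lr_minima w = j})"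
        using lr_minima_le_card[of _ P "A - {v}"] n by auto
      then have "card {w \<in> avoiders P A. lr_minima w = m} =
          card (\<Union>j\<in>{k..n}. {w \<in> avoiders P (A - {v}). lr_minima w = j})"
        using bij_betw_same_card[OF bij] m by simp
      also have "\<dots> = (\<Sum>j=k..n. card {w \<in> avoiders P (A - {v}). lr_minima w = j})"
        by (rule card_UN_disjoint) (auto simp: finite_avoiders)
      also have "\<dots> = (\<Sum>j=k..n. ballot n j)"
        using Suc.hyps(1)[OF n] n by simp
      finally show ?thesis using m Suc.hyps(2)[symmetric] by simp
    qed
  qed
qed

section \<open>The pattern 3-1-2\<close>

text \<open>The rank is strictly increasing, hence injective, and surjective by counting. So exactly
  one letter has a prescribed rank.\<close>

lemma bij_betw_rank:
  fixes A :: "'a :: linorder set"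
  assumes "finite A"
  shows "bij_betw (\<lambda>y. card {x \<in> A. x < y}) A {..<card A}"
proof -
  have mono: "card {x \<in> A. x < z} < card {x \<in> A. x < y}" if "z \<in> A" "z < y" for y z
    using that assms by (intro psubset_card_mono) auto
  have inj: "inj_on (\<lambda>y. card {x \<in> A. x < y}) A"
    by (rule linorder_inj_onI') (use mono in fastforce)
  have "card {x \<in> A. x < y} < card A" if "y \<in> A" for y
    using that assms by (intro psubset_card_mono) auto
  then have "(\<lambda>y. card {x \<in> A. x < y}) ` A \<subseteq> {..<card A}" by auto
  then have "(\<lambda>y. card {x \<in> A. x < y}) ` A = {..<card A}"
    by (intro card_subset_eq) (simp_all add: card_image inj)
  with inj show ?thesis by (simp add: bij_betw_def)
qed

text \<open>If b < c < a then b is below a as well, so the condition concerns only letters below a;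
  among distinct letters, having no ascent means being decreasing.\<close>

lemma sorted_wrt_distinct_not:
  fixes a :: nat
  assumes "distinct w"
  shows "sorted_wrt (\<lambda>b c. b < c \<longrightarrow> \<not> c < a) w \<longleftrightarrow> sorted_wrt (>) (filter (\<lambda>y. y < a) w)"
  using assms
proof (induction w)
  case (Cons x w)
  then show ?case by (cases "x < a") (auto simp: not_less le_less)
qed simp

text \<open>The letters below the first letter occur in decreasing order, so all of them are minima.
  Thus m + 1 minima force the first letter to have rank m, and deleting it is the bijection.\<close>

lemma avoiders_312_rec:
  assumes "finite A" "m < card A" and P: "P = (\<lambda>a b c. \<not> (b < c \<and> c < a))"
  shows "\<exists>v\<in>A. \<exists>f.
      bij_betw f {w \<in> avoiders P A. lr_minima w = Suc m} {w \<in> avoiders P (A - {v}). m \<le> lr_minima w}"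
proof -
  have "m \<in> (\<lambda>y. card {x \<in> A. x < y}) ` A"
    using bij_betw_imp_surj_on[OF bij_betw_rank[OF assms(1)]] assms(2) by simp
  then obtain v where v: "v \<in> A" "card {x \<in> A. x < v} = m" by auto
  have rank: "y = v" if "y \<in> A" "card {x \<in> A. x < y} = m" for y
    using bij_betw_rank[OF assms(1)] v that by (auto simp: bij_betw_def dest: inj_onD)
  have lr: "lr_minima (a # w) = Suc (card {x \<in> set (a # w). x < a})"
    if "distinct (a # w)" "triplewise P (a # w)" for a w
  proof -
    have "lr_minima (filter (\<lambda>y. y < a) w) = length (filter (\<lambda>y. y < a) w)"
      using that by (intro lr_minima_decreasing) (auto simp: P sorted_wrt_distinct_not)
    also have "\<dots> = card (set (filter (\<lambda>y. y < a) w))"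
      using that by (subst distinct_card) auto
    also have "set (filter (\<lambda>y. y < a) w) = {x \<in> set (a # w). x < a}" by auto
    finally show ?thesis by simp
  qed
  have hd: "\<exists>w'. w = v # w'" if "w \<in> avoiders P A" "lr_minima w = Suc m" for w
  proof (cases w)
    case (Cons a w')
    then show ?thesis using that lr[of a w'] rank[of a] by (auto simp: avoiders_def)
  qed (use that in auto)
  \<comment> \<open>Only triples starting with v are new, so it suffices that the letters of w below
    v decrease. The first letter a of w is either above v or, by the bound on the minima, its
    immediate predecessor in A.\<close>
  have extend: "triplewise P (v # w)" if "w \<in> avoiders P (A - {v})" "m \<le> lr_minima w" for w
  proof (cases w)
    case (Cons a w')
    have w: "distinct w" "set w = A - {v}" "triplewise P w" using that by (auto simp: avoiders_def)
    have dec: "sorted_wrt (>) (filter (\<lambda>y. y < a) w')"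
      using w Cons by (auto simp: P sorted_wrt_distinct_not)
    have a: "a \<in> A" "a \<noteq> v" using w Cons by auto
    have "sorted_wrt (>) (filter (\<lambda>y. y < v) w)"
    proof (cases "v < a")
      case True
      then have "filter (\<lambda>y. y < v) w = filter (\<lambda>y. y < v) (filter (\<lambda>y. y < a) w')"
        using Cons by (auto intro!: filter_cong)
      then show ?thesis using sorted_wrt_filter[OF dec] by simp
    next
      case False
      then have "a < v" using a by simp
      have "{x \<in> set w. x < a} = {x \<in> A. x < a}" unfolding w(2) using \<open>a < v\<close> by auto
      then have "lr_minima w = Suc (card {x \<in> A. x < a})"
        using lr[of a w'] w(1,3) unfolding Cons by metis
      then have "m \<le> card (insert a {x \<in> A. x < a})"
        using that(2) assms(1) by simp
      \<comment> \<open>The left set is contained in the right one and has at least m elements,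
        while the right one has exactly m. Hence no letter of A lies strictly between a and
        v.\<close>
      then have below_v: "insert a {x \<in> A. x < a} = {x \<in> A. x < v}"
        using \<open>a < v\<close> a v assms(1) by (intro card_seteq) auto
      have "filter (\<lambda>y. y < v) w' = filter (\<lambda>y. y < a) w'"
      proof (rule filter_cong[OF refl])
        fix y assume "y \<in> set w'"
        then have "y \<in> A" "y \<noteq> a" using w Cons by auto
        then show "(y < v) = (y < a)" using below_v by blast
      qed
      then show ?thesis using Cons dec \<open>a < v\<close> by simp
    qed
    then show ?thesis using w by (simp add: P sorted_wrt_distinct_not)
  qed simp
  have "bij_betw tl {w \<in> avoiders P A. lr_minima w = Suc m} {w \<in> avoiders P (A - {v}). m \<le> lr_minima w}"
  proof (rule bij_betw_byWitness[where f' = "(#) v"])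
    show "tl ` {w \<in> avoiders P A. lr_minima w = Suc m} \<subseteq> {w \<in> avoiders P (A - {v}). m \<le> lr_minima w}"
    proof clarify
      fix w assume "w \<in> avoiders P A" and m: "lr_minima w = Suc m"
      then obtain w' where w': "w = v # w'" using hd by blast
      \<comment> \<open>The minima of w after v are those of the letters of w' below v; there are m
        of them, and restoring the larger letters cannot lower the number.\<close>
      show "tl w \<in> avoiders P (A - {v}) \<and> m \<le> lr_minima (tl w)"
        using \<open>w \<in> avoiders P A\<close> m w' lr_minima_filter_less_le[of v w'] by (auto simp: avoiders_def)
    qed
    show "(#) v ` {w \<in> avoiders P (A - {v}). m \<le> lr_minima w} \<subseteq> {w \<in> avoiders P A. lr_minima w = Suc m}"
    proof clarify
      fix w assume w: "w \<in> avoiders P (A - {v})" "m \<le> lr_minima w"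
      then have "v # w \<in> avoiders P A" using extend v(1) by (auto simp: avoiders_def)
      then show "v # w \<in> avoiders P A \<and> lr_minima (v # w) = Suc m"
        using lr[of v w] v(2) by (auto simp: avoiders_def)
    qed
  qed (use hd in fastforce)+
  then show ?thesis using v(1) by blast
qed

section \<open>The smallest letter, and the pattern 2-3-1\<close>

lemma avoiders_split_Min:
  assumes "w \<in> avoiders P A" "finite A" "A \<noteq> {}"
  obtains u v where "w = u @ Min A # v" "\<forall>x\<in>set u \<union> set v. Min A < x" "distinct (u @ v)"
    "set (u @ v) = A - {Min A}"
proof -
  have w: "distinct w" "set w = A" using assms by (auto simp: avoiders_def)
  then obtain u v where uv: "w = u @ Min A # v"
    using assms by (metis Min_in split_list)
  have "set (u @ v) = A - {Min A}" using w uv by auto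
  moreover from this have "\<forall>x\<in>set u \<union> set v. Min A < x"
    using assms(2) by (auto simp: less_le)
  ultimately show thesis using that w uv by auto
qed

text \<open>An ascent x < y before a smaller letter a would form 2-3-1, so the letters in front of
  the smallest one decrease.\<close>

lemma decreasing_if_above:
  fixes a :: nat
  assumes "sorted_wrt (\<lambda>x y. \<not> (a < x \<and> x < y)) u" "distinct u" "\<forall>x\<in>set u. a < x"
  shows "sorted_wrt (>) u"
  using assms by (induction u) (auto simp: not_less le_less)

text \<open>The letters before the smallest one decrease, so together with it they are all the
  minima of w. As m is at most their number, the first m letters lie within this decreasing
  run.\<close>

lemma decreasing_prefix_231:
  assumes "w \<in> avoiders P A" "finite A" "m \<le> lr_minima w" and P: "P = (\<lambda>a b c. \<not> (c < a \<and> a < b))"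
  shows "sorted_wrt (>) (take m w)"
proof (cases "A = {}")
  case True
  then show ?thesis using assms by (auto simp: avoiders_def)
next
  case False
  obtain u v where uv: "w = u @ Min A # v" "\<forall>x\<in>set u \<union> set v. Min A < x" "distinct (u @ v)"
    using avoiders_split_Min[OF assms(1,2) False] by metis
  have "sorted_wrt (\<lambda>x y. \<not> (Min A < x \<and> x < y)) u"
    using assms(1) uv(1) by (simp add: avoiders_def triplewise_append P)
  then have dec: "sorted_wrt (>) u"
    using uv(2,3) by (intro decreasing_if_above[where a = "Min A"]) auto
  have "lr_minima w = Suc (length u)"
    using uv lr_minima_append_Min[of u "Min A" v] lr_minima_decreasing[OF dec] by simp
  then have "take m w = take m (u @ [Min A])"
    using assms(3) uv(1) by (auto simp: le_Suc_eq)
  moreover have "sorted_wrt (>) (u @ [Min A])"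
    using dec uv(2) by (simp add: sorted_wrt_append)
  ultimately show ?thesis by (simp add: sorted_wrt_take del: take_append)
qed

text \<open>With m + 1 minima the smallest letter stands behind exactly m decreasing letters.
  Deletion is therefore inverted by insertion after the first m letters.\<close>

lemma avoiders_231_rec:
  assumes "finite A" "m < card A" and P: "P = (\<lambda>a b c. \<not> (c < a \<and> a < b))"
  shows "\<exists>v\<in>A. \<exists>f.
      bij_betw f {w \<in> avoiders P A. lr_minima w = Suc m} {w \<in> avoiders P (A - {v}). m \<le> lr_minima w}"
proof -
  define a where "a = Min A"
  have "A \<noteq> {}" using assms(2) by auto
  then have a: "a \<in> A" "\<forall>x\<in>A - {a}. a < x"
    using assms(1) by (auto simp: a_def less_le)
  have split: "\<exists>u v. w = u @ a # v \<and> length u = m \<and> sorted_wrt (>) u \<and> a \<notin> set u \<and> u @ v \<in> avoiders P (A - {a})"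
    if w: "w \<in> avoiders P A" "lr_minima w = Suc m" for w
  proof -
    obtain u v where uv: "w = u @ a # v" "\<forall>x\<in>set u \<union> set v. a < x" "distinct (u @ v)"
        "set (u @ v) = A - {a}"
      using avoiders_split_Min[OF w(1) assms(1) \<open>A \<noteq> {}\<close>] unfolding a_def by metis
    have "lr_minima w = Suc (lr_minima u)"
      using uv(1,2) lr_minima_append_Min[of u a v] by simp
    have "sorted_wrt (\<lambda>x y. \<not> (a < x \<and> x < y)) u"
      using w(1) uv(1) by (simp add: avoiders_def triplewise_append P)
    then have dec: "sorted_wrt (>) u"
      using uv(2,3) by (intro decreasing_if_above[where a = a]) auto
    moreover have "length u = m"
      using lr_minima_decreasing[OF dec] w(2) \<open>lr_minima w = Suc (lr_minima u)\<close> by simp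
    moreover have "u @ v \<in> avoiders P (A - {a})"
      using w(1) uv by (auto simp: avoiders_def triplewise_append)
    ultimately show ?thesis using uv by blast
  qed
  have "bij_betw (remove1 a) {w \<in> avoiders P A. lr_minima w = Suc m} {w \<in> avoiders P (A - {a}). m \<le> lr_minima w}"
  proof (rule bij_betw_byWitness[where f' = "\<lambda>w. take m w @ a # drop m w"])
    show "\<forall>w\<in>{w \<in> avoiders P A. lr_minima w = Suc m}. take m (remove1 a w) @ a # drop m (remove1 a w) = w"
      using split by (fastforce simp: remove1_append)
    show "\<forall>w\<in>{w \<in> avoiders P (A - {a}). m \<le> lr_minima w}. remove1 a (take m w @ a # drop m w) = w"
      by (auto simp: avoiders_def remove1_append dest: in_set_takeD)
    show "remove1 a ` {w \<in> avoiders P A. lr_minima w = Suc m} \<subseteq> {w \<in> avoiders P (A - {a}). m \<le> lr_minima w}"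
    proof clarify
      fix w assume "w \<in> avoiders P A" "lr_minima w = Suc m"
      from split[OF this] obtain u v where "w = u @ a # v" "length u = m" "sorted_wrt (>) u" "a \<notin> set u"
        "u @ v \<in> avoiders P (A - {a})" by blast
      then show "remove1 a w \<in> avoiders P (A - {a}) \<and> m \<le> lr_minima (remove1 a w)"
        by (simp add: remove1_append lr_minima_append lr_minima_decreasing)
    qed
    show "(\<lambda>w. take m w @ a # drop m w) ` {w \<in> avoiders P (A - {a}). m \<le> lr_minima w}
        \<subseteq> {w \<in> avoiders P A. lr_minima w = Suc m}"
    proof clarify
      fix w assume w: "w \<in> avoiders P (A - {a})" "m \<le> lr_minima w"
      define u v where "u = take m w" and "v = drop m w"
      have uv: "w = u @ v" by (simp add: u_def v_def)
      have len: "length u = m"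
        using w lr_minima_le_length[of w] by (simp add: u_def)
      have dec: "sorted_wrt (>) u"
        using decreasing_prefix_231[OF w(1) _ w(2) P] assms(1) by (simp add: u_def)
      have "set u \<union> set v = A - {a}" "distinct (u @ v)" using w(1) uv by (auto simp: avoiders_def)
      then have gt: "\<forall>x\<in>set u. a < x" "\<forall>x\<in>set v. a < x" using a by auto
      have "triplewise P (u @ v)" using w(1) uv by (simp add: avoiders_def)
      moreover have "sorted_wrt (P a) v" "\<forall>x\<in>set u. \<forall>y\<in>set v. P x a y"
        using gt by (auto simp: P intro!: sorted_wrt_if_all)
      \<comment> \<open>The smallest letter can only play the 1 of 2-3-1, and the decreasing prefix
        offers no ascent for the 2 and the 3.\<close>
      moreover have "sorted_wrt (\<lambda>x y. P x y a) u"
        by (rule sorted_wrt_mono_rel[OF _ dec]) (auto simp: P)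
      ultimately have "triplewise P (u @ a # v)" by (simp add: triplewise_append)
      then have "u @ a # v \<in> avoiders P A"
        using \<open>set u \<union> set v = A - {a}\<close> \<open>distinct (u @ v)\<close> a gt by (auto simp: avoiders_def)
      moreover have "lr_minima (u @ a # v) = Suc m"
        using lr_minima_append_Min[OF gt] lr_minima_decreasing[OF dec] len by simp
      ultimately show "take m w @ a # drop m w \<in> avoiders P A \<and> lr_minima (take m w @ a # drop m w) = Suc m"
        by (simp add: u_def v_def)
    qed
  qed
  then show ?thesis using a(1) by blast
qed

section \<open>The pattern 2-1-3\<close>

text \<open>The cut marks where the smallest letter can be inserted. It is found from the right:
  unless the cut is at the very end, dropping the last letter z leaves at least m minima, and the
  cut of the shorter word survives adding z.\<close>

lemma split_213:
  assumes "triplewise (\<lambda>a b c. \<not> (b < a \<and> a < c)) w" "distinct w" "m \<le> lr_minima w"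
  shows "\<exists>u v. w = u @ v \<and> lr_minima u = m \<and> (\<forall>x\<in>set u. \<forall>y\<in>set v. y < x)"
  using assms
proof (induction w rule: rev_induct)
  case (snoc z w)
  show ?case
  proof (cases "lr_minima (w @ [z]) = m")
    case True
    then show ?thesis by (intro exI[of _ "w @ [z]"] exI[of _ "[]"]) auto
  next
    case False
    have "m \<le> lr_minima w"
      using False snoc.prems(3) by (auto simp: lr_minima_append split: if_splits)
    then obtain u v where uv: "w = u @ v" "lr_minima u = m" "\<forall>x\<in>set u. \<forall>y\<in>set v. y < x"
      using snoc by (auto simp: triplewise_append)
    \<comment> \<open>If v is empty, z must be a new minimum. Otherwise the first letter y of v is
      below every x in u, and y < x < z would make x, y, z a 2-1-3.\<close>
    have "\<forall>x\<in>set u. z < x"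
    proof (cases v)
      case Nil
      then show ?thesis using False uv by (auto simp: lr_minima_append split: if_splits)
    next
      case (Cons y v')
      have "sorted_wrt (\<lambda>x y. \<not> (y < x \<and> x < z)) w"
        using snoc.prems(1) by (simp add: triplewise_append)
      then have "\<forall>x\<in>set u. \<not> (y < x \<and> x < z)"
        using uv(1) Cons by (simp add: sorted_wrt_append)
      then show ?thesis using uv(1,3) Cons snoc.prems(2) by (auto simp: not_less le_less)
    qed
    then show ?thesis using uv by (intro exI[of _ u] exI[of _ "v @ [z]"]) auto
  qed
qed auto

text \<open>Two cuts differ by a block t lying below the shorter prefix; a nonempty t would
  contribute a further minimum.\<close>

lemma split_213_unique:
  assumes "u @ v = u' @ v'" "lr_minima u = lr_minima u'"
    and "\<forall>x\<in>set u. \<forall>y\<in>set v. y < x" "\<forall>x\<in>set u'. \<forall>y\<in>set v'. y < x"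
  shows "u = u' \<and> v = v'"
proof -
  have aux: "t = []" if "lr_minima (u @ t) = lr_minima u" "\<forall>x\<in>set u. \<forall>y\<in>set (t @ v). y < x" for u t v
  proof -
    have "filter (\<lambda>y. \<forall>x\<in>set u. y < x) t = t" using that by (simp add: filter_id_conv)
    then show ?thesis using that lr_minima_pos[of t] by (auto simp: lr_minima_append)
  qed
  from assms(1) consider t where "u = u' @ t" "v' = t @ v" | t where "u' = u @ t" "v = t @ v'"
    by (metis append_eq_append_conv2)
  then show ?thesis
  proof cases
    case (1 t)
    then have "t = []" using aux[of u' t v] assms(2,4) by simp
    then show ?thesis using 1 by simp
  next
    case (2 t)
    then have "t = []" using aux[of u t v'] assms(2,3) by simp
    then show ?thesis using 2 by simp
  qed
qed

text \<open>Around the smallest letter a, a triple x, a, y avoids 2-1-3 only if y < x, so deleting a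
  leaves a cut as in \<open>split_213\<close>. Existence of the cut gives surjectivity of the
  deletion, uniqueness gives injectivity.\<close>

lemma avoiders_213_rec:
  assumes "finite A" "m < card A" and P: "P = (\<lambda>a b c. \<not> (b < a \<and> a < c))"
  shows "\<exists>v\<in>A. \<exists>f.
      bij_betw f {w \<in> avoiders P A. lr_minima w = Suc m} {w \<in> avoiders P (A - {v}). m \<le> lr_minima w}"
proof -
  define a where "a = Min A"
  have "A \<noteq> {}" using assms(2) by auto
  then have a: "a \<in> A" "\<forall>x\<in>A - {a}. a < x"
    using assms(1) by (auto simp: a_def less_le)
  have split: "\<exists>u v. w = u @ a # v \<and> remove1 a w = u @ v \<and> lr_minima u = m \<and>
      (\<forall>x\<in>set u. \<forall>y\<in>set v. y < x) \<and> u @ v \<in> avoiders P (A - {a})"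
    if w: "w \<in> avoiders P A" "lr_minima w = Suc m" for w
  proof -
    obtain u v where uv: "w = u @ a # v" "\<forall>x\<in>set u \<union> set v. a < x" "distinct (u @ v)"
        "set (u @ v) = A - {a}"
      using avoiders_split_Min[OF w(1) assms(1) \<open>A \<noteq> {}\<close>] unfolding a_def by metis
    have "lr_minima u = m"
      using uv(1,2) w(2) lr_minima_append_Min[of u a v] by simp
    moreover have "\<forall>x\<in>set u. \<forall>y\<in>set v. y < x"
    proof (intro ballI)
      fix x y assume xy: "x \<in> set u" "y \<in> set v"
      then have "\<not> (a < x \<and> x < y)"
        using w(1) uv(1) by (simp add: avoiders_def triplewise_append P)
      moreover have "a < x" "x \<noteq> y" using xy uv(2,3) by auto
      ultimately show "y < x" by simp
    qed
    moreover have "u @ v \<in> avoiders P (A - {a})"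
      using w(1) uv by (auto simp: avoiders_def triplewise_append)
    moreover have "remove1 a w = u @ v" using uv by (auto simp: remove1_append)
    ultimately show ?thesis using uv by blast
  qed
  have "bij_betw (remove1 a) {w \<in> avoiders P A. lr_minima w = Suc m} {w \<in> avoiders P (A - {a}). m \<le> lr_minima w}"
    unfolding bij_betw_def
  proof
    show "inj_on (remove1 a) {w \<in> avoiders P A. lr_minima w = Suc m}"
    proof (rule inj_onI)
      fix w w'
      assume "w \<in> {w \<in> avoiders P A. lr_minima w = Suc m}" "w' \<in> {w \<in> avoiders P A. lr_minima w = Suc m}"
        and eq: "remove1 a w = remove1 a w'"
      then have w: "w \<in> avoiders P A" "lr_minima w = Suc m" and w': "w' \<in> avoiders P A" "lr_minima w' = Suc m"
        by auto
      obtain u v where uv: "w = u @ a # v" "remove1 a w = u @ v" "lr_minima u = m"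
          "\<forall>x\<in>set u. \<forall>y\<in>set v. y < x"
        using split[OF w] by blast
      obtain u' v' where uv': "w' = u' @ a # v'" "remove1 a w' = u' @ v'" "lr_minima u' = m"
          "\<forall>x\<in>set u'. \<forall>y\<in>set v'. y < x"
        using split[OF w'] by blast
      have "u = u' \<and> v = v'"
        by (rule split_213_unique) (use uv uv' eq in auto)
      then show "w = w'" using uv(1) uv'(1) by simp
    qed
    show "remove1 a ` {w \<in> avoiders P A. lr_minima w = Suc m} = {w \<in> avoiders P (A - {a}). m \<le> lr_minima w}"
    proof (rule equalityI; clarify)
      fix w assume "w \<in> avoiders P A" "lr_minima w = Suc m"
      from split[OF this] obtain u v where "remove1 a w = u @ v" "lr_minima u = m"
        "u @ v \<in> avoiders P (A - {a})" by blast
      then show "remove1 a w \<in> avoiders P (A - {a}) \<and> m \<le> lr_minima (remove1 a w)"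
        by (simp add: lr_minima_append)
    next
      fix w assume w: "w \<in> avoiders P (A - {a})" "m \<le> lr_minima w"
      then obtain u v where uv: "w = u @ v" "lr_minima u = m" "\<forall>x\<in>set u. \<forall>y\<in>set v. y < x"
        using split_213[of w m] by (auto simp: avoiders_def P)
      have "set u \<union> set v = A - {a}" "distinct (u @ v)" using w(1) uv by (auto simp: avoiders_def)
      then have gt: "\<forall>x\<in>set u. a < x" "\<forall>x\<in>set v. a < x" using a by auto
      have "triplewise P (u @ v)" using w(1) uv by (simp add: avoiders_def)
      \<comment> \<open>The smallest letter can only play the 1 of 2-1-3, and the cut excludes a
        larger letter behind it for the 3.\<close>
      moreover have "\<forall>x\<in>set u. \<forall>y\<in>set v. P x a y"
        using uv(3) by (auto simp: P dest: less_asym)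
      moreover have "sorted_wrt (P a) v" "sorted_wrt (\<lambda>x y. P x y a) u"
        using gt by (auto simp: P intro!: sorted_wrt_if_all)
      ultimately have "triplewise P (u @ a # v)" by (simp add: triplewise_append)
      then have "u @ a # v \<in> avoiders P A"
        using \<open>set u \<union> set v = A - {a}\<close> \<open>distinct (u @ v)\<close> a gt by (auto simp: avoiders_def)
      moreover have "lr_minima (u @ a # v) = Suc m"
        using lr_minima_append_Min[OF gt] uv(2) by simp
      moreover have "w = remove1 a (u @ a # v)" using gt uv(1) by (auto simp: remove1_append)
      ultimately show "w \<in> remove1 a ` {w \<in> avoiders P A. lr_minima w = Suc m}"
        by (intro image_eqI[of _ _ "u @ a # v"]) auto
    qed
  qed
  then show ?thesis using a(1) by blast
qed

section \<open>The standard cycle form\<close>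

text \<open>The shape of a standard cycle form, detached from any permutation: each block is led by
  its smallest letter, and the leaders decrease.\<close>

definition block_list :: "nat list list \<Rightarrow> bool" where
  "block_list css \<longleftrightarrow> (\<forall>c\<in>set css. c \<noteq> [] \<and> (\<forall>y\<in>set (tl c). hd c < y)) \<and> sorted_wrt (>) (map hd css)"

text \<open>If the first blocks differed, one would be a proper prefix of the other. The next letter
  would then be below the common leader, as leader of a new block, and also above it, as a member of
  the longer block.\<close>

lemma concat_block_list_inj:
  assumes "block_list css" "block_list dss" "concat css = concat dss"
  shows "css = dss"
  using assms
proof (induction css arbitrary: dss)
  case Nil
  then show ?case by (cases dss) (auto simp: block_list_def)
next
  case (Cons c cs)
  from Cons.prems obtain d ds where dss: "dss = d # ds"
    by (cases dss) (auto simp: block_list_def)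
  have aux: "t = []"
    if "block_list (c # cs)" "block_list ((c @ t) # ds)" "concat cs = t @ concat ds" for c t cs ds
  proof (rule ccontr)
    assume "t \<noteq> []"
    then obtain e es where cs: "cs = e # es"
      using \<open>concat cs = t @ concat ds\<close> by (cases cs) auto
    have "c \<noteq> []" "e \<noteq> []" "hd e < hd c" using that(1) cs by (auto simp: block_list_def)
    moreover have "hd e = hd t"
      using that(3) cs \<open>t \<noteq> []\<close> \<open>e \<noteq> []\<close> by (metis concat.simps(2) hd_append2)
    moreover have "hd c < hd t"
      using that(2) \<open>t \<noteq> []\<close> \<open>c \<noteq> []\<close> by (auto simp: block_list_def)
    ultimately show False by simp
  qed
  have "c @ concat cs = d @ concat ds" using Cons.prems(3) dss by simp
  then consider t where "c = d @ t" "concat ds = t @ concat cs" | t where "d = c @ t" "concat cs = t @ concat ds"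
    by (metis append_eq_append_conv2)
  then have cd: "c = d"
  proof cases
    case (1 t)
    then show ?thesis using aux[of d ds t cs] Cons.prems dss by simp
  next
    case (2 t)
    then show ?thesis using aux[of c cs t ds] Cons.prems dss by simp
  qed
  then have "cs = ds"
    using Cons.IH[of ds] Cons.prems dss by (auto simp: block_list_def)
  then show ?case using cd dss by simp
qed

text \<open>The minima are exactly the block leaders: the rest of a block is above its leader, and
  the next leader is below all previous ones.\<close>

lemma lr_minima_concat_block_list: "block_list css \<Longrightarrow> lr_minima (concat css) = length css"
proof (induction css)
  case (Cons c cs)
  then obtain a t where c: "c = a # t" "\<forall>y\<in>set t. a < y"
    by (cases c) (auto simp: block_list_def)
  have t: "filter (\<lambda>y. y < a) t = []" using c(2) by (auto simp: filter_empty_conv)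
  \<comment> \<open>The remaining word starts with a leader b < a, after which only letters below b
    count; filtering by a first changes nothing.\<close>
  have "lr_minima (filter (\<lambda>y. y < a) (concat cs)) = lr_minima (concat cs)"
  proof (cases cs)
    case (Cons d ds)
    with Cons.prems obtain b s where d: "d = b # s" "b < a"
      using c by (cases d) (auto simp: block_list_def)
    have "filter (\<lambda>y. y < b) (filter (\<lambda>y. y < a) (s @ concat ds)) = filter (\<lambda>y. y < b) (s @ concat ds)"
      unfolding filter_filter using d(2) by (intro filter_cong) auto
    then show ?thesis using Cons d by simp
  qed simp
  moreover have "block_list cs" using Cons.prems by (auto simp: block_list_def)
  ultimately show ?case using Cons.IH c t by simp
qed simp

context
  fixes n :: nat and p :: "nat \<Rightarrow> nat"
  assumes p: "p permutes {1..n}"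
begin

lemma permutation_p: "permutation p"
  using p by (auto simp: permutation_permutes)

lemma set_support_eq_orbit: "set (support p a) = orbit p a"
  using support_set[OF permutation_p, of a] orbit_altdef_permutation[OF permutation_p, of a] by auto

lemma disjoint_cycle_sets: "pairwise disjnt (cycle_sets n p)"
  using disjoint_support[OF permutation_p]
  unfolding set_support_eq_orbit disjoint_def cycle_sets_def pairwise_def disjnt_def by blast

lemma cycle_sets_cover: "\<Union> (cycle_sets n p) = {1..n}"
proof
  show "\<Union> (cycle_sets n p) \<subseteq> {1..n}"
    unfolding cycle_sets_def using permutes_orbit_subset[OF p] by blast
  show "{1..n} \<subseteq> \<Union> (cycle_sets n p)"
    unfolding cycle_sets_def using permutation_self_in_orbit[OF permutation_p] by blast
qed

lemma Min_cycle_in: "C \<in> cycle_sets n p \<Longrightarrow> Min C \<in> C"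
  unfolding cycle_sets_def using permutation_self_in_orbit[OF permutation_p] finite_orbit
  by (metis Min_in imageE orbit_nonempty)

lemma support_Min:
  assumes "C \<in> cycle_sets n p"
  shows "set (support p (Min C)) = C"
proof -
  obtain x where "C = orbit p x" using assms by (auto simp: cycle_sets_def)
  then show ?thesis
    unfolding set_support_eq_orbit
    using Min_cycle_in[OF assms] orbit_cyclic_eq3[OF cyclic_on_orbit'[OF permutation_p]] by blast
qed

lemma finite_cycle_sets: "finite (cycle_sets n p)"
  by (simp add: cycle_sets_def)

text \<open>A cycle is recovered from its minimum as the set of letters of the cycle written from
  there.\<close>

lemma inj_on_Min_cycle_sets: "inj_on Min (cycle_sets n p)"
  by (rule inj_onI) (metis support_Min)

lemma support_Cons: "support p a = a # tl (support p a)"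
  using least_power_of_permutation(2)[OF permutation_p, of a] by (simp add: upt_rec)

lemma hd_support: "hd (support p a) = a"
  by (metis support_Cons list.sel(1))

lemma set_standard_cycle_form: "set (standard_cycle_form n p) = support p ` Min ` cycle_sets n p"
  using finite_cycle_sets by (simp add: standard_cycle_form_def)

lemma block_list_standard_cycle_form: "block_list (standard_cycle_form n p)"
proof -
  have "map hd (standard_cycle_form n p) = rev (sorted_list_of_set (Min ` cycle_sets n p))"
    unfolding standard_cycle_form_def map_map
    by (rule map_idI) (simp only: o_apply hd_support)
  moreover have "sorted_wrt (>) (rev (sorted_list_of_set (Min ` cycle_sets n p)))"
    by (simp add: sorted_wrt_rev)
  moreover have "c \<noteq> [] \<and> (\<forall>y\<in>set (tl c). hd c < y)" if c_in: "c \<in> set (standard_cycle_form n p)" for c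
  proof -
    obtain C where C: "C \<in> cycle_sets n p" "c = support p (Min C)"
      using c_in unfolding set_standard_cycle_form by blast
    have c: "c = Min C # tl c" using support_Cons C(2) by blast
    have "distinct c" using cycle_of_permutation[OF permutation_p] C(2) by blast
    have "set c = C" using support_Min C by blast
    then have "finite C" by (metis List.finite_set)
    have "\<forall>y\<in>set (tl c). Min C < y"
    proof
      fix y assume y: "y \<in> set (tl c)"
      then have "y \<in> C" using c \<open>set c = C\<close> by (metis list.set_intros(2))
      moreover have "y \<noteq> Min C" using c y \<open>distinct c\<close> by (metis distinct.simps(2))
      ultimately show "Min C < y" using \<open>finite C\<close> by (simp add: less_le)
    qed
    then show ?thesis using c by (metis list.distinct(1) list.sel(1))
  qed
  ultimately show ?thesis unfolding block_list_def by simp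
qed

text \<open>Minima correspond to block leaders, and distinct cycles have distinct minima, so there
  is one block per cycle.\<close>

lemma lr_minima_Psi: "lr_minima (Psi n p) = num_cycles n p"
  unfolding Psi_def lr_minima_concat_block_list[OF block_list_standard_cycle_form]
  by (simp add: standard_cycle_form_def num_cycles_def card_image inj_on_Min_cycle_sets)

lemma set_Psi: "set (Psi n p) = {1..n}"
proof -
  have "set (Psi n p) = (\<Union>C\<in>cycle_sets n p. set (support p (Min C)))"
    unfolding Psi_def set_concat set_standard_cycle_form by blast
  also have "\<dots> = \<Union> (cycle_sets n p)" using support_Min by simp
  finally show ?thesis unfolding cycle_sets_cover .
qed

lemma distinct_Psi: "distinct (Psi n p)"
  unfolding Psi_def distinct_concat_iff
proof (intro conjI allI impI)
  \<comment> \<open>The leaders decrease strictly, so no block occurs twice.\<close>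
  have "distinct (map hd (standard_cycle_form n p))"
    using block_list_standard_cycle_form unfolding block_list_def
    by (metis distinct_rev rev_map sorted_wrt_rev strict_sorted_iff)
  then show "distinct (removeAll [] (standard_cycle_form n p))"
    by (simp add: distinct_map distinct_removeAll)
next
  fix c assume "c \<in> set (standard_cycle_form n p)"
  then show "distinct c"
    using cycle_of_permutation[OF permutation_p] unfolding set_standard_cycle_form by blast
next
  fix c d assume "c \<in> set (standard_cycle_form n p) \<and> d \<in> set (standard_cycle_form n p) \<and> c \<noteq> d"
  then obtain C D where "C \<in> cycle_sets n p" "D \<in> cycle_sets n p" "c = support p (Min C)"
    "d = support p (Min D)" "C \<noteq> D"
    unfolding set_standard_cycle_form by blast
  then show "set c \<inter> set d = {}"
    using disjoint_cycle_sets support_Min unfolding pairwise_def disjnt_def by metis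
qed

end

section \<open>Deleting the parentheses as a bijection\<close>

text \<open>The written cycle lists the successive images of a, so it determines the permutation on
  all its letters.\<close>

lemma support_eq_imp:
  assumes "permutation p" "permutation q" "support p a = support q a" "x \<in> set (support p a)"
  shows "p x = q x"
proof -
  have len: "least_power p a = least_power q a"
    using arg_cong[OF assms(3), of length] by simp
  \<comment> \<open>The exponent \<open>least_power p a\<close> is included: it covers the image of
    the last letter, which wraps around to a.\<close>
  have eq: "(p ^^ i) a = (q ^^ i) a" if "i \<le> least_power p a" for i
  proof (cases "i = least_power p a")
    case True
    then show ?thesis
      using least_power_of_permutation(1)[OF assms(1), of a] least_power_of_permutation(1)[OF assms(2), of a] len
      by simp
  next
    case False
    then have "support p a ! i = (p ^^ i) a" "support q a ! i = (q ^^ i) a"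
      using that len by auto
    then show ?thesis using assms(3) by simp
  qed
  obtain i where i: "i < least_power p a" "x = (p ^^ i) a" using assms(4) by auto
  have "p x = (p ^^ Suc i) a" "q x = (q ^^ Suc i) a" using i eq[of i] by auto
  then show ?thesis using eq[of "Suc i"] i(1) by simp
qed

text \<open>The word determines its blocks, the blocks determine the permutation on {1..n}, and
  outside this set every such permutation is the identity.\<close>

lemma inj_on_Psi: "inj_on (Psi n) {p. p permutes {1..n}}"
proof (rule inj_onI; clarify)
  fix p q assume p: "p permutes {1..n}" and q: "q permutes {1..n}" and eq: "Psi n p = Psi n q"
  have form: "standard_cycle_form n p = standard_cycle_form n q"
    using concat_block_list_inj[OF block_list_standard_cycle_form[OF p] block_list_standard_cycle_form[OF q]] eq
    by (simp add: Psi_def)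
  show "p = q"
  proof
    fix x
    show "p x = q x"
    proof (cases "x \<in> {1..n}")
      case True
      then have "x \<in> set (Psi n p)" using set_Psi[OF p] by simp
      then obtain c where c: "c \<in> set (standard_cycle_form n p)" "x \<in> set c"
        by (auto simp: Psi_def)
      then obtain a where a: "c = support p a" using set_standard_cycle_form[OF p] by auto
      obtain b where b: "c = support q b" using c(1) form set_standard_cycle_form[OF q] by auto
      have "a = b" using a b hd_support[OF p] hd_support[OF q] by metis
      then show ?thesis
        using support_eq_imp[OF permutation_p[OF p] permutation_p[OF q], of a x] a b c(2) by metis
    next
      case False
      then show ?thesis using p q by (metis permutes_not_in)
    qed
  qed
qed

text \<open>Injectivity suffices, since both sets have n! elements.\<close>

lemma bij_betw_Psi: "bij_betw (Psi n) {p. p permutes {1..n}} (permutations_of_set {1..n})"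
proof -
  have "Psi n ` {p. p permutes {1..n}} \<subseteq> permutations_of_set {1..n}"
    using set_Psi distinct_Psi by (auto simp: permutations_of_set_def)
  moreover have "card (permutations_of_set {1..n}) = card (Psi n ` {p. p permutes {1..n}})"
    using card_image[OF inj_on_Psi, of n] by (simp add: card_permutations)
  ultimately show ?thesis
    unfolding bij_betw_def using inj_on_Psi card_subset_eq[of "permutations_of_set {1..n}"] by simp
qed

lemma card_cyclic_avoiders:
  "card (cyclic_avoiders n m s) =
     card {w \<in> avoiders (\<lambda>a b c. \<not> order_isomorphic [a, b, c] s) {1..n}. lr_minima w = m}"
  (is "_ = card ?W")
proof (rule bij_betw_same_card[of "Psi n"])
  have "?W = {w \<in> permutations_of_set {1..n}. lr_minima w = m \<and> avoids3 w s}"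
    by (auto simp: avoiders_def permutations_of_set_def avoids3_iff_triplewise)
  also have "\<dots> = Psi n ` cyclic_avoiders n m s"
    unfolding bij_betw_imp_surj_on[OF bij_betw_Psi, symmetric]
    by (auto simp: cyclic_avoiders_def cyclically_avoids_def lr_minima_Psi)
  finally have "Psi n ` cyclic_avoiders n m s = ?W" by simp
  moreover have "inj_on (Psi n) (cyclic_avoiders n m s)"
    by (rule inj_on_subset[OF inj_on_Psi]) (auto simp: cyclic_avoiders_def)
  ultimately show "bij_betw (Psi n) (cyclic_avoiders n m s) ?W"
    by (simp add: bij_betw_def)
qed

theorem mainTheorem14:
  fixes n m :: nat
  assumes "1 \<le> n" and "1 \<le> m" and "m \<le> n"
  shows "card (cyclic_avoiders n m [3, 1, 2]) = card {d \<in> dyck_paths n. num_returns d = m} \<and>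
         card (cyclic_avoiders n m [2, 3, 1]) = card {d \<in> dyck_paths n. num_returns d = m} \<and>
         card (cyclic_avoiders n m [2, 1, 3]) = card {d \<in> dyck_paths n. num_returns d = m} \<and>
         real (card {d \<in> dyck_paths n. num_returns d = m}) =
           real m / real (2 * n - m) * real ((2 * n - m) choose n)"
  \<comment> \<open>Here \<open>refl\<close> instantiates P with the inequality form that
    \<open>order_isomorphic_patterns\<close> gives for the respective pattern.\<close>
  using card_avoiders_eq_ballot[OF avoiders_312_rec[OF _ _ refl], of "{1..n}" m]
    card_avoiders_eq_ballot[OF avoiders_231_rec[OF _ _ refl], of "{1..n}" m]
    card_avoiders_eq_ballot[OF avoiders_213_rec[OF _ _ refl], of "{1..n}" m]
    ballot_closed_form[OF assms(1,3)]
  unfolding card_cyclic_avoiders order_isomorphic_patterns card_dyck_paths_returns by simp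

end
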